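(* There exists a countably infinite set $P$ of points in the Euclidean plane $\mathbb{R}^2$ such that no 4 points of $P$ are collinear and no 3 points of $P$ are pairwise visible with respect to $P$.
   Context: Let $P$ be a set of points in the plane. Two distinct points $v$ and $w$ in the plane are called visible with respect to $P$ if no point of $P$ lies in the open line segment $\overline{vw}$ (the segment between $v$ and $w$, excluding its endpoints). A set of points is pairwise visible if every two distinct points in it are visible with respect to $P$. *)

theory Defs
  imports "HOL-Analysis.Analysis"
begin

definition visible :: "(real^2) set \<Rightarrow> real^2 \<Rightarrow> real^2 \<Rightarrow> bool" where
  "visible P v w \<longleftrightarrow> v \<noteq> w \<and> P \<inter> open_segment v w = {}"

definition pairwise_visible :: "(real^2) set \<Rightarrow> (real^2) set \<Rightarrow> bool" where
  "pairwise_visible P S \<longleftrightarrow> pairwise (visible P) S"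

end

theory Submission
  imports Defs
begin

text \<open>
  Build the points one at a time so that every new point lies on at most one line through two
  earlier points, and then strictly between these two. The last of any four collinear points would
  violate this, so no four points become collinear. Moreover, three points that see each other
  always include an ordinary pair, one whose line contains no third point: a later point on the
  line would block its side of the triangle, and if both sides at the last vertex contained an
  earlier point, the last vertex would lie on two old lines or block the third side. A generic point
  between an ordinary pair is a legal next point, and it destroys the visible triple. Doing this in
  stages, each of which destroys all visible triples of the finite set built so far, leaves no
  visible triple in the union.
\<close>

lemma open_segment_subset_affine_hull: "open_segment a b \<subseteq> affine hull {a, b}"
  using convex_hull_subset_affine_hull by (auto simp: open_segment_def segment_convex_hull)

lemma affine_hull_pair_eq:
  fixes p :: "'a::euclidean_space"
  assumes "p \<noteq> q" "p \<in> affine hull {a, b}" "q \<in> affine hull {a, b}"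
  shows "affine hull {p, q} = affine hull {a, b}"
proof (rule affine_dim_equal)
  show subset: "affine hull {p, q} \<subseteq> affine hull {a, b}"
    using assms by (intro hull_minimal) (auto simp: affine_affine_hull)
  have "aff_dim {p, q} \<le> aff_dim {a, b}"
    using aff_dim_subset[OF subset] by (simp only: aff_dim_affine_hull)
  then show "aff_dim (affine hull {p, q}) = aff_dim (affine hull {a, b})"
    using \<open>p \<noteq> q\<close> by (simp add: aff_dim_affine_hull split: if_splits)
qed (auto simp: affine_affine_hull)

lemma finite_Int_lines:
  fixes a :: "'a::euclidean_space"
  assumes "affine hull {a, b} \<noteq> affine hull {c, d}"
  shows "finite (affine hull {a, b} \<inter> affine hull {c, d})"
proof -
  have "p = q" if "p \<in> affine hull {a, b} \<inter> affine hull {c, d}"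
    "q \<in> affine hull {a, b} \<inter> affine hull {c, d}" for p q
    using that assms affine_hull_pair_eq[of p q] by (metis IntE)
  then obtain p where "affine hull {a, b} \<inter> affine hull {c, d} \<subseteq> {p}"
    by blast
  then show ?thesis
    by (rule finite_subset) simp
qed

lemma negligible_affine_hull:
  fixes S :: "'a::euclidean_space set"
  assumes "finite S" "card S \<le> DIM('a)"
  shows "negligible (affine hull S)"
  using empty_interior_affine_hull[OF assms]
  by (simp add: negligible_convex_interior affine_imp_convex affine_affine_hull)

lemma ex_point_off_lines:
  fixes A :: "'a::euclidean_space set"
  assumes "countable A" and dim: "2 \<le> DIM('a)"
  shows "\<exists>y. \<forall>a\<in>A. \<forall>b\<in>A. y \<notin> affine hull {a, b}"
proof -
  have "negligible (affine hull {a, b})" for a b :: 'a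
    using dim card_insert_le_m1[of 2 "{b}" a] by (intro negligible_affine_hull) auto
  then have "negligible (\<Union>((\<lambda>(a, b). affine hull {a, b}) ` (A \<times> A)))"
    using \<open>countable A\<close> by (intro negligible_countable_Union) auto
  then have "(\<Union>(a, b)\<in>A \<times> A. affine hull {a, b}) \<noteq> UNIV"
    using non_negligible_UNIV by metis
  then show ?thesis
    by auto
qed

lemma finite_subset_UN_mono:
  fixes A :: "'i::linorder \<Rightarrow> 'a set"
  assumes "mono A" "finite S" "S \<subseteq> (\<Union>i. A i)"
  obtains i where "S \<subseteq> A i"
proof -
  have "A i \<subseteq> A j \<or> A j \<subseteq> A i" for i j
    using \<open>mono A\<close> by (metis linear monoD)
  then have "subset.chain UNIV (range A)"
    by (simp add: subset_chain_def)
  then show thesis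
    using finite_subset_Union_chain[of S "range A"] assms(2,3) that by blast
qed

definition mutually_visible :: "'a::real_vector set \<Rightarrow> 'a set \<Rightarrow> bool" where
  "mutually_visible A S \<longleftrightarrow> pairwise (\<lambda>v w. A \<inter> open_segment v w = {}) S"

lemma mutually_visible_antimono:
  "A \<subseteq> B \<Longrightarrow> mutually_visible B S \<Longrightarrow> mutually_visible A S"
  unfolding mutually_visible_def by (erule pairwise_mono) auto

lemma mutually_visibleD:
  "mutually_visible A S \<Longrightarrow> v \<in> S \<Longrightarrow> w \<in> S \<Longrightarrow> y \<in> A \<Longrightarrow> y \<notin> open_segment v w"
  by (cases "v = w") (auto simp: mutually_visible_def pairwise_def)

definition admissible :: "'a::real_vector set \<Rightarrow> 'a \<Rightarrow> bool" where
  "admissible A y \<longleftrightarrow> y \<notin> A \<and>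
    (\<forall>a\<in>A. \<forall>b\<in>A. a \<noteq> b \<and> y \<in> affine hull {a, b} \<longrightarrow> y \<in> open_segment a b) \<and>
    (\<forall>a\<in>A. \<forall>b\<in>A. \<forall>c\<in>A. \<forall>d\<in>A. a \<noteq> b \<and> c \<noteq> d \<and>
      y \<in> affine hull {a, b} \<and> y \<in> affine hull {c, d} \<longrightarrow> {a, b} = {c, d})"

lemma admissible_notin: "admissible A y \<Longrightarrow> y \<notin> A"
  by (simp add: admissible_def)

lemma admissible_in_open_segment:
  "admissible A y \<Longrightarrow> a \<in> A \<Longrightarrow> b \<in> A \<Longrightarrow> a \<noteq> b \<Longrightarrow> y \<in> affine hull {a, b} \<Longrightarrow> y \<in> open_segment a b"
  by (simp add: admissible_def)

lemma admissible_unique_pair: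
  assumes "admissible A y"
    and "a \<in> A" "b \<in> A" "a \<noteq> b" "y \<in> affine hull {a, b}"
    and "c \<in> A" "d \<in> A" "c \<noteq> d" "y \<in> affine hull {c, d}"
  shows "{a, b} = {c, d}"
  using assms unfolding admissible_def by blast

lemma ex_admissible:
  fixes A :: "'a::euclidean_space set"
  assumes "countable A" "2 \<le> DIM('a)"
  shows "\<exists>y. admissible A y"
proof -
  obtain y where off_lines: "\<forall>a\<in>A. \<forall>b\<in>A. y \<notin> affine hull {a, b}"
    using ex_point_off_lines[OF assms] by blast
  moreover from off_lines have "y \<notin> A"
    by (metis hull_inc insertI1)
  ultimately show ?thesis
    unfolding admissible_def by blast
qed

lemma admissible_collinear_card_le_2:
  fixes A :: "'a::euclidean_space set"
  assumes admissible: "admissible A y" and "T \<subseteq> A" and collinear: "collinear (insert y T)"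
  shows "card T \<le> 2"
proof (rule ccontr)
  assume "\<not> ?thesis"
  then have "3 \<le> card T"
    by simp
  then obtain a b c where in_T: "a \<in> T" "b \<in> T" "c \<in> T"
    and distinct: "a \<noteq> b" "a \<noteq> c" "b \<noteq> c"
    by (metis obtain_subset_with_card_n card_3_iff insert_subset)
  have "y \<in> affine hull {p, q}" if "p \<in> T" "q \<in> T" "p \<noteq> q" for p q
  proof -
    have "collinear {p, q, y}"
      using collinear by (rule collinear_subset) (use that in auto)
    with \<open>p \<noteq> q\<close> show ?thesis
      by (simp add: collinear_3_affine_hull)
  qed
  then have "{a, b} = {a, c}"
    using in_T distinct \<open>T \<subseteq> A\<close> by (intro admissible_unique_pair[OF admissible]) auto
  with distinct show False
    by (auto simp: doubleton_eq_iff)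
qed

definition ordinary_pair :: "'a::real_vector set \<Rightarrow> 'a \<Rightarrow> 'a \<Rightarrow> bool" where
  "ordinary_pair A a b \<longleftrightarrow> a \<noteq> b \<and> A \<inter> affine hull {a, b} = {a, b}"

lemma ordinary_pair_finite_Int_line:
  fixes A :: "'a::euclidean_space set"
  assumes ordinary: "ordinary_pair A a b"
    and other_pair: "c \<in> A" "d \<in> A" "c \<noteq> d" "{c, d} \<noteq> {a, b}"
  shows "finite (affine hull {a, b} \<inter> affine hull {c, d})"
proof (rule finite_Int_lines)
  have "A \<inter> affine hull {a, b} = {a, b}"
    using ordinary by (simp add: ordinary_pair_def)
  moreover have "{c, d} \<subseteq> A \<inter> affine hull {c, d}"
    using other_pair by (simp add: hull_inc)
  moreover have "\<not> {c, d} \<subseteq> {a, b}"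
    using other_pair by auto
  ultimately show "affine hull {a, b} \<noteq> affine hull {c, d}"
    by metis
qed

lemma ordinary_pair_ex_admissible:
  fixes A :: "'a::euclidean_space set"
  assumes "finite A" and ordinary: "ordinary_pair A a b"
  shows "\<exists>y\<in>open_segment a b. admissible A y"
proof -
  define other_pairs where
    "other_pairs = {(c, d). c \<in> A \<and> d \<in> A \<and> c \<noteq> d \<and> {c, d} \<noteq> {a, b}}"
  define forbidden where
    "forbidden = A \<union> (\<Union>(c, d)\<in>other_pairs. affine hull {a, b} \<inter> affine hull {c, d})"
  have "other_pairs \<subseteq> A \<times> A"
    by (auto simp: other_pairs_def)
  then have "finite other_pairs"
    using \<open>finite A\<close> by (meson finite_SigmaI finite_subset)
  then have "finite forbidden"
    using \<open>finite A\<close> ordinary_pair_finite_Int_line[OF ordinary]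
    by (auto simp: forbidden_def other_pairs_def)
  moreover have "infinite (open_segment a b)"
    using ordinary by (simp add: ordinary_pair_def)
  ultimately obtain y where between: "y \<in> open_segment a b" and allowed: "y \<notin> forbidden"
    by (meson finite_subset subsetI)
  then have "y \<in> affine hull {a, b}" "y \<notin> A"
    using open_segment_subset_affine_hull by (auto simp: forbidden_def)
  with allowed have only_ab: "{c, d} = {a, b}"
    if "c \<in> A" "d \<in> A" "c \<noteq> d" "y \<in> affine hull {c, d}" for c d
    using that by (auto simp: forbidden_def other_pairs_def)
  then have "y \<in> open_segment c d"
    if "c \<in> A" "d \<in> A" "c \<noteq> d" "y \<in> affine hull {c, d}" for c d
    using that between by (metis doubleton_eq_iff open_segment_commute)
  with \<open>y \<notin> A\<close> only_ab have "admissible A y"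
    unfolding admissible_def by (metis (no_types))
  with between show ?thesis
    by blast
qed

lemma ordinary_pair_insert:
  assumes "ordinary_pair A a b" "admissible A y" "y \<notin> open_segment a b"
  shows "ordinary_pair (insert y A) a b"
proof -
  have "a \<in> A" "b \<in> A" "a \<noteq> b"
    using assms(1) by (auto simp: ordinary_pair_def)
  then have "y \<notin> affine hull {a, b}"
    using assms(2,3) admissible_in_open_segment by blast
  with assms(1) show ?thesis
    by (simp add: ordinary_pair_def)
qed

lemma not_ordinary_pair_insertE:
  fixes A :: "'a::euclidean_space set"
  assumes "\<not> ordinary_pair (insert y A) y u" "u \<in> A" "y \<notin> A"
  obtains s where "s \<in> A" "s \<noteq> u" "y \<in> affine hull {u, s}"
proof -
  have "{y, u} \<subseteq> insert y A \<inter> affine hull {y, u}"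
    using \<open>u \<in> A\<close> by (auto simp: hull_inc)
  then obtain s where s_on_line: "s \<in> A" "s \<noteq> u" "s \<in> affine hull {y, u}"
    using assms unfolding ordinary_pair_def by blast
  then have "affine hull {u, s} = affine hull {y, u}"
    by (intro affine_hull_pair_eq) (auto simp: hull_inc)
  with s_on_line that show thesis
    by (simp add: hull_inc)
qed

lemma ordinary_pair_at_admissible_vertex:
  fixes A :: "'a::euclidean_space set"
  assumes admissible: "admissible A y" and base: "u \<in> A" "v \<in> A" "u \<noteq> v"
    and not_between: "y \<notin> open_segment u v"
  shows "ordinary_pair (insert y A) y u \<or> ordinary_pair (insert y A) y v"
proof (rule ccontr)
  assume "\<not> ?thesis"
  then obtain s t where s_on_line: "s \<in> A" "s \<noteq> u" "y \<in> affine hull {u, s}"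
    and "t \<in> A" "t \<noteq> v" "y \<in> affine hull {v, t}"
    using not_ordinary_pair_insertE[of y A] base admissible_notin[OF admissible] by metis
  then have "{u, s} = {v, t}"
    using base by (intro admissible_unique_pair[OF admissible]) auto
  then have "s = v"
    using \<open>u \<noteq> v\<close> by (auto simp: doubleton_eq_iff)
  with s_on_line base have "y \<in> open_segment u v"
    by (intro admissible_in_open_segment[OF admissible]) auto
  with not_between show False ..
qed

inductive constructible :: "'a::real_vector set \<Rightarrow> bool" where
  empty: "constructible {}"
| insert: "constructible A \<Longrightarrow> admissible A y \<Longrightarrow> constructible (insert y A)"

lemma constructible_imp_finite: "constructible A \<Longrightarrow> finite A"
  by (induction rule: constructible.induct) auto

lemma constructible_collinear_card_le_3:
  fixes A :: "'a::euclidean_space set"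
  assumes "constructible A" "S \<subseteq> A" "collinear S"
  shows "card S \<le> 3"
  using assms
proof (induction arbitrary: S rule: constructible.induct)
  case (insert A y)
  show ?case
  proof (cases "y \<in> S")
    case False
    with insert show ?thesis
      by (metis subset_insert)
  next
    case True
    have "S - {y} \<subseteq> A" "collinear (insert y (S - {y}))"
      using insert.prems True by (auto simp: insert_absorb)
    then have "card (S - {y}) \<le> 2"
      by (rule admissible_collinear_card_le_2[OF \<open>admissible A y\<close>])
    then show ?thesis
      using True by (simp add: card_Diff_singleton)
  qed
qed simp

lemma constructible_visible_triple_ordinary_pair:
  fixes A :: "'a::euclidean_space set"
  assumes "constructible A" "S \<subseteq> A" "card S = 3" "mutually_visible A S"
  shows "\<exists>a\<in>S. \<exists>b\<in>S. ordinary_pair A a b"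
  using assms
proof (induction arbitrary: S rule: constructible.induct)
  case (insert A y)
  note unblocked = mutually_visibleD[OF \<open>mutually_visible (insert y A) S\<close>]
  show ?case
  proof (cases "y \<in> S")
    case False
    moreover have "mutually_visible A S"
      using insert.prems by (blast intro: mutually_visible_antimono)
    ultimately obtain a b where "a \<in> S" "b \<in> S" "ordinary_pair A a b"
      using insert.IH[of S] insert.prems by blast
    moreover from this have "ordinary_pair (insert y A) a b"
      using \<open>admissible A y\<close> unblocked by (blast intro: ordinary_pair_insert)
    ultimately show ?thesis
      by blast
  next
    case True
    then have "card (S - {y}) = 2"
      using insert.prems by simp
    then obtain u v where "S - {y} = {u, v}" "u \<noteq> v"
      by (auto simp: card_2_iff)
    then have "u \<in> S" "v \<in> S" "u \<in> A" "v \<in> A"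
      using insert.prems by blast+
    then show ?thesis
      using ordinary_pair_at_admissible_vertex[OF \<open>admissible A y\<close>, of u v] unblocked True \<open>u \<noteq> v\<close>
      by blast
  qed
qed simp

lemma constructible_ex_blocking_triple:
  fixes A :: "'a::euclidean_space set"
  assumes "constructible A" "S \<subseteq> A" "card S = 3"
  shows "\<exists>B. constructible B \<and> A \<subseteq> B \<and> \<not> mutually_visible B S"
proof (cases "mutually_visible A S")
  case False
  with assms show ?thesis
    by blast
next
  case True
  then obtain a b where visible_pair: "a \<in> S" "b \<in> S" "ordinary_pair A a b"
    using constructible_visible_triple_ordinary_pair assms by blast
  then obtain y where between: "y \<in> open_segment a b" and admissible: "admissible A y"
    using ordinary_pair_ex_admissible assms(1) constructible_imp_finite by blast
  have "\<not> mutually_visible (insert y A) S"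
    using visible_pair between mutually_visibleD by blast
  moreover have "constructible (insert y A)"
    using assms(1) admissible by (rule constructible.insert)
  ultimately show ?thesis
    by blast
qed

lemma constructible_ex_blocking_triples:
  fixes A :: "'a::euclidean_space set"
  assumes "finite F" "constructible A" "\<And>S. S \<in> F \<Longrightarrow> S \<subseteq> A \<and> card S = 3"
  shows "\<exists>B. constructible B \<and> A \<subseteq> B \<and> (\<forall>S\<in>F. \<not> mutually_visible B S)"
  using assms
proof (induction rule: finite_induct)
  case empty
  then show ?case
    by blast
next
  case (insert S F)
  then obtain B where B_blocks_F: "constructible B" "A \<subseteq> B" "\<forall>T\<in>F. \<not> mutually_visible B T"
    by auto
  moreover have "S \<subseteq> B" "card S = 3"
    using insert.prems(2)[of S] B_blocks_F(2) by auto
  ultimately obtain C where "constructible C" "B \<subseteq> C" "\<not> mutually_visible C S"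
    using constructible_ex_blocking_triple by blast
  with B_blocks_F show ?case
    by (blast dest: mutually_visible_antimono)
qed

lemma constructible_ex_blocking_all_triples:
  fixes A :: "'a::euclidean_space set"
  assumes constructible: "constructible A" and dim: "2 \<le> DIM('a)"
  shows "\<exists>B. constructible B \<and> A \<subset> B \<and> (\<forall>S. S \<subseteq> A \<and> card S = 3 \<longrightarrow> \<not> mutually_visible B S)"
proof -
  have "finite A"
    using constructible by (rule constructible_imp_finite)
  then obtain y where admissible: "admissible A y"
    using ex_admissible dim countable_finite by blast
  have "finite {S. S \<subseteq> A \<and> card S = 3}"
    using \<open>finite A\<close> by simp
  moreover have "constructible (insert y A)"
    using constructible admissible by (rule constructible.insert)
  ultimately obtain B where "constructible B" "insert y A \<subseteq> B"
    "\<forall>S\<in>{S. S \<subseteq> A \<and> card S = 3}. \<not> mutually_visible B S"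
    using constructible_ex_blocking_triples[of "{S. S \<subseteq> A \<and> card S = 3}" "insert y A"] by blast
  with admissible_notin[OF admissible] show ?thesis
    by blast
qed

lemma ex_constructible_blocking_sequence:
  assumes "2 \<le> DIM('a::euclidean_space)"
  shows "\<exists>A :: nat \<Rightarrow> 'a set. \<forall>n. constructible (A n) \<and> A n \<subset> A (Suc n) \<and>
    (\<forall>S. S \<subseteq> A n \<and> card S = 3 \<longrightarrow> \<not> mutually_visible (A (Suc n)) S)"
proof (rule dependent_nat_choice)
  show "\<exists>A :: 'a set. constructible A"
    using constructible.empty by blast
qed (rule constructible_ex_blocking_all_triples[OF _ assms])

theorem ex_infinite_no_four_collinear_no_three_visible:
  assumes "2 \<le> DIM('a::euclidean_space)"
  shows "\<exists>P :: 'a set. countable P \<and> infinite P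
    \<and> (\<forall>S. S \<subseteq> P \<and> card S = 4 \<longrightarrow> \<not> collinear S)
    \<and> (\<forall>S. S \<subseteq> P \<and> card S = 3 \<longrightarrow> \<not> mutually_visible P S)"
proof -
  obtain A :: "nat \<Rightarrow> 'a set" where constructible: "\<And>n. constructible (A n)"
    and growing: "\<And>n. A n \<subset> A (Suc n)"
    and blocked: "\<And>n S. S \<subseteq> A n \<Longrightarrow> card S = 3 \<Longrightarrow> \<not> mutually_visible (A (Suc n)) S"
    using ex_constructible_blocking_sequence[OF assms] by metis
  define P where "P = (\<Union>n. A n)"
  have "mono A"
    using growing by (intro incseq_SucI) blast
  then have in_stage: "\<exists>n. S \<subseteq> A n" if "S \<subseteq> P" "finite S" for S
    using finite_subset_UN_mono that unfolding P_def by metis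
  have "\<not> collinear S" if subset: "S \<subseteq> P" and card_S: "card S = 4" for S
  proof
    obtain n where "S \<subseteq> A n"
      using in_stage[OF subset] card_S card_ge_0_finite[of S] by auto
    moreover assume "collinear S"
    ultimately have "card S \<le> 3"
      by (rule constructible_collinear_card_le_3[OF constructible])
    with card_S show False
      by simp
  qed
  moreover have "\<not> mutually_visible P S" if subset: "S \<subseteq> P" and card_S: "card S = 3" for S
  proof -
    obtain n where "S \<subseteq> A n"
      using in_stage[OF subset] card_S card_ge_0_finite[of S] by auto
    then have "\<not> mutually_visible (A (Suc n)) S"
      using blocked card_S by blast
    then show ?thesis
      using mutually_visible_antimono[of "A (Suc n)" P] by (auto simp: P_def)
  qed
  moreover have "infinite P"
    using in_stage[of P] growing unfolding P_def by blast
  moreover have "countable P"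
    using constructible by (auto simp: P_def intro: countable_finite constructible_imp_finite)
  ultimately show ?thesis
    by blast
qed

lemma pairwise_visible_eq_mutually_visible: "pairwise_visible = mutually_visible"
  by (simp add: fun_eq_iff pairwise_visible_def mutually_visible_def visible_def pairwise_def)

theorem mainTheorem1:
  shows "\<exists>P :: (real^2) set. countable P \<and> infinite P
    \<and> (\<forall>S. S \<subseteq> P \<and> card S = 4 \<longrightarrow> \<not> collinear S)
    \<and> (\<forall>S. S \<subseteq> P \<and> card S = 3 \<longrightarrow> \<not> pairwise_visible P S)"
  unfolding pairwise_visible_eq_mutually_visible
  by (rule ex_infinite_no_four_collinear_no_three_visible) simp

end
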